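(* Let $L\in\mathbb{Z}^d$, $L\ne\mathbf 0$, and for $n\in\mathbb{N}$ let $F_n$ be the multivariate Fejér kernel $$F_n(x)=\sum_{k\in\mathbb{Z}^d,\ \|k\|_\infty<n}\left(1-\frac{\|k\|_\infty}{n}\right)e^{2\pi i\langle k,x\rangle}.$$ Then $$\mathrm{UP}^{\mathbb{T}^d}_L(F_n)\to\frac{(d+1)^2(d+2)^2}{6d(d+3)(d+4)},\qquad n\to\infty.$$
   Context: $\mathbb{T}^d=\mathbb{R}^d/\mathbb{Z}^d$; $\langle\cdot,\cdot\rangle$ and $\|\cdot\|$ on $\mathbb{R}^d$ are Euclidean, $\|k\|_\infty=\max_j|k_j|$; $\|f\|_{\mathbb{T}^d}$ and $\langle f,g\rangle=\int_{\mathbb{T}^d}f\overline g\,dx$ are the norm and inner product of $L_2(\mathbb{T}^d)$. For $L\in\mathbb{Z}^d\setminus\{\mathbf 0\}$ let $\mathcal{A}_Lf(x)=e^{2\pi i\langle L,x\rangle}f(x)$ and $\mathcal{B}_Lf(x)=\frac{i}{2\pi}\sum_{j=1}^dL_j\frac{\partial f}{\partial x_j}(x)$. The directional uncertainty product is $$\mathrm{UP}^{\mathbb{T}^d}_L(f)=\frac{1}{\|L\|^4}\left(\frac{\|f\|_{\mathbb{T}^d}^4}{|\langle\mathcal{A}_Lf,f\rangle|^2}-1\right)\left(\frac{\|\mathcal{B}_Lf\|_{\mathbb{T}^d}^2}{\|f\|_{\mathbb{T}^d}^2}-\frac{|\langle\mathcal{B}_Lf,f\rangle|^2}{\|f\|_{\mathbb{T}^d}^4}\right),$$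 defined when $\langle\mathcal{A}_Lf,f\rangle\ne0$ (which holds for $f=F_n$ with $n$ large). *)

theory Defs
  imports "HOL-Analysis.Analysis"
begin

text \<open>
  The dimension \<open>d\<close> is \<^term>\<open>CARD('d)\<close>.  A function on the torus \<open>\<real>\<^sup>d/\<int>\<^sup>d\<close> is given by a function on
  \<open>\<real>\<^sup>d\<close> that is 1-periodic in every variable; integration over the torus is Lebesgue integration
  over the fundamental domain \<open>[0,1]\<^sup>d\<close>.
\<close>

definition real_vec :: "int ^ 'd \<Rightarrow> real ^ 'd" where
  "real_vec k = (\<chi> j. real_of_int (k $ j))"

definition torus_inner :: "(real ^ 'd \<Rightarrow> complex) \<Rightarrow> (real ^ 'd \<Rightarrow> complex) \<Rightarrow> complex" where
  "torus_inner f g = (LINT x:cbox 0 1|lebesgue. f x * cnj (g x))"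

definition torus_norm :: "(real ^ 'd \<Rightarrow> complex) \<Rightarrow> real" where
  "torus_norm f = sqrt (LINT x:cbox 0 1|lebesgue. (cmod (f x))\<^sup>2)"

definition partial_deriv :: "'d \<Rightarrow> (real ^ 'd \<Rightarrow> complex) \<Rightarrow> real ^ 'd \<Rightarrow> complex" where
  "partial_deriv j f x = vector_derivative (\<lambda>t. f (x + t *\<^sub>R axis j 1)) (at 0)"

definition op_A :: "int ^ 'd \<Rightarrow> (real ^ 'd \<Rightarrow> complex) \<Rightarrow> real ^ 'd \<Rightarrow> complex" where
  "op_A L f x = exp (2 * of_real pi * \<i> * of_real (real_vec L \<bullet> x)) * f x"

definition op_B :: "int ^ 'd \<Rightarrow> (real ^ 'd \<Rightarrow> complex) \<Rightarrow> real ^ 'd \<Rightarrow> complex" where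
  "op_B L f x = \<i> / (2 * of_real pi) * (\<Sum>j\<in>UNIV. of_int (L $ j) * partial_deriv j f x)"

text \<open>
  The uncertainty product is meaningful only if \<^term>\<open>torus_inner (op_A L f) f \<noteq> 0\<close>.  For the smooth
  \<open>f\<close> considered here, if this fails then the totalised division makes the first
  parenthesis \<open>-1\<close>, while the second is nonnegative by Cauchy-Schwarz (and \<open>0\<close> for \<open>f = 0\<close>), so
  the value is \<open>\<le> 0\<close>.  Hence convergence to a positive limit entails that the product is
  eventually well defined.
\<close>

definition UP :: "int ^ 'd \<Rightarrow> (real ^ 'd \<Rightarrow> complex) \<Rightarrow> real" where
  "UP L f =
     1 / norm (real_vec L) ^ 4
     * (torus_norm f ^ 4 / (cmod (torus_inner (op_A L f) f))\<^sup>2 - 1)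
     * ((torus_norm (op_B L f))\<^sup>2 / (torus_norm f)\<^sup>2
        - (cmod (torus_inner (op_B L f) f))\<^sup>2 / torus_norm f ^ 4)"

definition fejer_kernel :: "nat \<Rightarrow> real ^ 'd \<Rightarrow> complex" where
  "fejer_kernel n x =
     (\<Sum>k | infnorm (real_vec k) < real n.
        of_real (1 - infnorm (real_vec k) / real n)
        * exp (2 * of_real pi * \<i> * of_real (real_vec k \<bullet> x)))"

text \<open>The index set is finite, so the sum above is a genuine one.\<close>

lemma finite_fejer_index: "finite {k :: int ^ 'd. infnorm (real_vec k) < real n}"
proof -
  let ?S = "{k :: int ^ 'd. infnorm (real_vec k) < real n}"
  have "vec_nth ` ?S \<subseteq> (UNIV :: 'd set) \<rightarrow>\<^sub>E {- int n..int n}"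
  proof (clarsimp simp: PiE_iff)
    fix k :: "int ^ 'd" and i :: 'd
    assume "infnorm (real_vec k) < real n"
    moreover have "\<bar>real_vec k $ i\<bar> \<le> infnorm (real_vec k)"
      by (rule component_le_infnorm_cart)
    ultimately have "\<bar>k $ i\<bar> < int n"
      by (simp add: real_vec_def)
    then show "- int n \<le> k $ i \<and> k $ i \<le> int n"
      by linarith
  qed
  then have "finite (vec_nth ` ?S)"
    by (rule finite_subset) (intro finite_PiE; simp)
  then show ?thesis
    by (rule finite_imageD) (simp add: inj_on_def vec_nth_inject)
qed

end

theory Submission
  imports Defs
begin

text \<open>
  By orthogonality of characters the three inner products are lattice sums in the tent function
  \<open>h(k) = max 0 (n - \<parallel>k\<parallel>\<^sub>\<infinity>)\<close>, and \<open>\<langle>B F, F\<rangle> = 0\<close> by parity.  Since \<open>h\<close> is the sum of the indicators of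
  the cubes \<open>Q\<^sub>r\<close>, \<open>r < n\<close>, each lattice sum is a double sum over \<open>r, s < n\<close> of a quantity that factors
  over the coordinates: \<open>\<bar>Q\<^sub>r \<inter> Q\<^sub>s\<bar>\<close>, \<open>\<bar>Q\<^sub>r \<inter> (Q\<^sub>s - L)\<bar>\<close>, or the second moment of \<open>Q\<^sub>r \<inter> Q\<^sub>s\<close>.  The
  difference \<open>\<bar>Q\<^sub>r \<inter> Q\<^sub>s\<bar> - \<bar>Q\<^sub>r \<inter> (Q\<^sub>s - L)\<bar>\<close> vanishes unless \<open>\<bar>r - s\<bar>\<close> is bounded, so the
  cancellation in the first factor of the product is exact.  The Stolz--Cesaro theorem, applied to the
  increments in \<open>n\<close>, gives all growth rates.
\<close>

subsection \<open>Fourier analysis on the torus\<close>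

definition torus_char :: "int ^ 'd \<Rightarrow> real ^ 'd \<Rightarrow> complex" where
  "torus_char k x = exp (2 * of_real pi * \<i> * of_real (real_vec k \<bullet> x))"

text \<open>For nonzero \<open>c\<close> the antiderivative is exp(w t) / w with w = 2 pi i c, and
  integrality of \<open>c\<close> makes it agree at both endpoints. The indicator form matches the
  factors that Fubini produces on the unit cube.\<close>

lemma integral_unit_interval_char:
  fixes c :: real
  assumes "c \<in> \<int>"
  shows "integrable lborel (\<lambda>t. indicator {0..1::real} t *\<^sub>R exp (2 * of_real pi * \<i> * of_real (c * t)))"
    and "(\<integral>t. indicator {0..1::real} t *\<^sub>R exp (2 * of_real pi * \<i> * of_real (c * t)) \<partial>lborel)
      = (if c = 0 then 1 else 0 :: complex)"
proof -
  let ?f = "\<lambda>t::real. exp (2 * of_real pi * \<i> * of_real (c * t)) :: complex"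
  have cont: "continuous_on {0..1} ?f"
    by (intro continuous_intros)
  show "integrable lborel (\<lambda>t. indicator {0..1} t *\<^sub>R ?f t)"
    by (rule borel_integrable_compact[OF _ cont]) simp
  show "(\<integral>t. indicator {0..1} t *\<^sub>R ?f t \<partial>lborel) = (if c = 0 then 1 else 0 :: complex)"
  proof (cases "c = 0")
    case False
    let ?w = "2 * of_real pi * \<i> * of_real c :: complex"
    have w: "?w \<noteq> 0"
      using False by simp
    have "((\<lambda>t. exp (?w * of_real t) / ?w) has_vector_derivative ?f t) (at t within {0..1})" for t
    proof -
      have "((\<lambda>z. exp (?w * z) / ?w) has_field_derivative exp (?w * of_real t)) (at (of_real t))"
        using False by (auto intro!: derivative_eq_intros simp: field_simps)
      from has_vector_derivative_real_field[OF this]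
      show ?thesis
        by (simp add: mult.assoc)
    qed
    then have "(\<integral>t. indicator {0..1} t *\<^sub>R ?f t \<partial>lborel)
        = exp (?w * of_real 1) / ?w - exp (?w * of_real 0) / ?w"
      by (intro integral_FTC_atLeastAtMost cont) auto
    also have "exp (?w * of_real 1) = 1"
      using assms by (auto elim!: Ints_cases simp: exp_eq_1 intro!: exI[of _ "\<lfloor>c\<rfloor>"])
    finally show ?thesis
      using False by simp
  qed simp
qed

text \<open>The indicator of the unit cube and the character both factor over the coordinates, so
  the integral is a product of one-dimensional ones; a single nonzero component of \<open>k\<close>
  makes it vanish.\<close>

lemma integral_torus_char:
  fixes k :: "int ^ 'd"
  shows "integrable lborel (\<lambda>x. indicator (cbox 0 1) x *\<^sub>R torus_char k x)"
    and "(\<integral>x. indicator (cbox 0 1) x *\<^sub>R torus_char k x \<partial>lborel) = (if k = 0 then 1 else 0)"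
proof -
  interpret product_sigma_finite "\<lambda>_::real ^ 'd. lborel :: real measure"
    by standard
  define g :: "real ^ 'd \<Rightarrow> real \<Rightarrow> complex" where
    "g = (\<lambda>b t. indicator {0..1} t *\<^sub>R exp (2 * of_real pi * \<i> * of_real ((real_vec k \<bullet> b) * t)))"
  let ?F = "\<lambda>x. indicator (cbox 0 1) x *\<^sub>R torus_char k x"
  have cont: "continuous_on (cbox 0 1) (torus_char k)"
    unfolding torus_char_def by (intro continuous_intros)
  show int: "integrable lborel ?F"
    by (rule borel_integrable_compact[OF _ cont]) simp
  have ints: "real_vec k \<bullet> b \<in> \<int>" if "b \<in> Basis" for b
    using that by (auto simp: Basis_vec_def inner_axis real_vec_def)
  have zero: "(\<forall>b\<in>Basis. real_vec k \<bullet> b = 0) \<longleftrightarrow> k = 0"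
    by (auto simp: Basis_vec_def inner_axis real_vec_def vec_eq_iff)
  have one: "(1 :: real ^ 'd) \<bullet> b = 1" if "b \<in> Basis" for b
    using that by (auto simp: Basis_vec_def inner_axis)
  have split: "?F (\<Sum>b\<in>Basis. y b *\<^sub>R b) = (\<Prod>b\<in>Basis. g b (y b))" for y
  proof -
    let ?x = "\<Sum>b\<in>Basis. y b *\<^sub>R b"
    have "indicator (cbox 0 1) ?x = (\<Prod>b\<in>Basis. indicator {0..1} (y b) :: real)"
      by (auto simp: indicator_def mem_box one prod_zero_iff)
    moreover have "real_vec k \<bullet> ?x = (\<Sum>b\<in>Basis. (real_vec k \<bullet> b) * y b)"
      by (simp add: inner_sum_right mult.commute)
    ultimately show ?thesis
      by (simp add: g_def torus_char_def scaleR_conv_of_real prod.distrib exp_sum sum_distrib_left)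
  qed
  have "(\<integral>x. ?F x \<partial>lborel) = (\<integral>y. ?F (\<Sum>b\<in>Basis. y b *\<^sub>R b) \<partial>(\<Pi>\<^sub>M b\<in>Basis. lborel))"
    using int by (subst lborel_eq, subst integral_distr) auto
  also have "\<dots> = (\<integral>y. (\<Prod>b\<in>Basis. g b (y b)) \<partial>(\<Pi>\<^sub>M b\<in>Basis. lborel))"
    by (simp only: split)
  also have "\<dots> = (\<Prod>b\<in>Basis. \<integral>t. g b t \<partial>lborel)"
    by (rule product_integral_prod) (simp_all only: g_def finite_Basis integral_unit_interval_char(1) ints)
  also have "\<dots> = (\<Prod>b\<in>Basis. if real_vec k \<bullet> b = 0 then 1 else 0)"
    unfolding g_def by (intro prod.cong refl integral_unit_interval_char(2) ints)
  also have "\<dots> = (if k = 0 then 1 else 0)"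
    using zero by (auto simp: prod_zero_iff)
  finally show "(\<integral>x. ?F x \<partial>lborel) = (if k = 0 then 1 else 0)" .
qed

lemma torus_char_add: "torus_char (k + l) x = torus_char k x * torus_char l x"
proof -
  have "real_vec (k + l) = real_vec k + real_vec l"
    by (simp add: real_vec_def vec_eq_iff)
  then show ?thesis
    by (simp add: torus_char_def inner_add_left distrib_left exp_add)
qed

lemma torus_char_mult_cnj: "torus_char k x * cnj (torus_char l x) = torus_char (k - l) x"
proof -
  have "real_vec (k - l) = real_vec k - real_vec l"
    by (simp add: real_vec_def vec_eq_iff)
  then show ?thesis
    by (simp add: torus_char_def inner_diff_left right_diff_distrib exp_diff exp_cnj exp_minus
        divide_inverse)
qed

text \<open>Orthogonality of characters. Separate frequency maps \<open>p\<close> and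
  \<open>q\<close> accommodate the shifted frequencies of \<open>op_A\<close> without reindexing the
  sum.\<close>

lemma torus_inner_trig_sums:
  fixes p :: "'i \<Rightarrow> int ^ 'd" and q :: "'j \<Rightarrow> int ^ 'd"
  assumes "finite I" "finite J"
  shows "torus_inner (\<lambda>x. \<Sum>i\<in>I. a i * torus_char (p i) x) (\<lambda>x. \<Sum>j\<in>J. b j * torus_char (q j) x)
    = (\<Sum>i\<in>I. \<Sum>j\<in>J. if p i = q j then a i * cnj (b j) else 0)"
proof -
  let ?f = "\<lambda>x. \<Sum>i\<in>I. a i * torus_char (p i) x" and ?g = "\<lambda>x. \<Sum>j\<in>J. b j * torus_char (q j) x"
  let ?h = "\<lambda>i j x. indicator (cbox 0 1) x *\<^sub>R torus_char (p i - q j) x"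
  have eq: "indicator (cbox 0 1) x *\<^sub>R (?f x * cnj (?g x))
      = (\<Sum>i\<in>I. \<Sum>j\<in>J. (a i * cnj (b j)) * ?h i j x)" for x :: "real ^ 'd"
    by (simp add: sum_product sum_distrib_left torus_char_mult_cnj[symmetric] mult_ac
        scaleR_conv_of_real, rule sum.swap)
  have int: "integrable lborel (\<lambda>x. (a i * cnj (b j)) * ?h i j x)" for i j
    by (intro integrable_mult_right integral_torus_char(1))
  have "torus_inner ?f ?g = (\<integral>x. (\<Sum>i\<in>I. \<Sum>j\<in>J. (a i * cnj (b j)) * ?h i j x) \<partial>lebesgue)"
    by (simp only: torus_inner_def set_lebesgue_integral_def eq)
  \<comment> \<open>\<open>torus_inner\<close> integrates against the completed measure, whereas the
    character integrals are over \<open>lborel\<close>; for a Borel integrand the two agree.\<close>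
  also have "\<dots> = (\<integral>x. (\<Sum>i\<in>I. \<Sum>j\<in>J. (a i * cnj (b j)) * ?h i j x) \<partial>lborel)"
  proof (rule integral_completion)
    have "integrable lborel (\<lambda>x. \<Sum>i\<in>I. \<Sum>j\<in>J. (a i * cnj (b j)) * ?h i j x)"
      by (intro Bochner_Integration.integrable_sum int)
    then show "(\<lambda>x. \<Sum>i\<in>I. \<Sum>j\<in>J. (a i * cnj (b j)) * ?h i j x) \<in> borel_measurable lborel"
      by (rule borel_measurable_integrable)
  qed
  also have "\<dots> = (\<Sum>i\<in>I. \<Sum>j\<in>J. (a i * cnj (b j)) * (\<integral>x. ?h i j x \<partial>lborel))"
    by (simp only: Bochner_Integration.integral_sum Bochner_Integration.integrable_sum int
        integral_mult_right_zero)
  also have "\<dots> = (\<Sum>i\<in>I. \<Sum>j\<in>J. if p i = q j then a i * cnj (b j) else 0)"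
    by (intro sum.cong refl) (simp add: integral_torus_char(2) del: mult_scaleR_right)
  finally show ?thesis .
qed

text \<open>Lets the norms, like the inner products, be computed by
  \<open>torus_inner_trig_sums\<close>.\<close>

lemma torus_norm_eq_inner: "torus_norm f = sqrt (Re (torus_inner f f))"
proof -
  have "torus_inner f f = (LINT x:cbox 0 1|lebesgue. complex_of_real ((cmod (f x))\<^sup>2))"
    by (simp only: torus_inner_def complex_norm_square)
  also have "\<dots> = complex_of_real (LINT x:cbox 0 1|lebesgue. (cmod (f x))\<^sup>2)"
    by (rule set_integral_complex_of_real)
  finally show ?thesis
    by (simp add: torus_norm_def)
qed

lemma op_A_trig_sum:
  "op_A L (\<lambda>x. \<Sum>k\<in>K. a k * torus_char k x) = (\<lambda>x. \<Sum>k\<in>K. a k * torus_char (k + L) x)"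
  unfolding op_A_def torus_char_def[of L, symmetric]
  by (simp add: torus_char_add sum_distrib_left mult_ac)

lemma partial_deriv_trig_sum:
  fixes K :: "(int ^ 'd) set"
  shows "partial_deriv j (\<lambda>x. \<Sum>k\<in>K. a k * torus_char k x)
    = (\<lambda>x. \<Sum>k\<in>K. 2 * of_real pi * \<i> * of_int (k $ j) * a k * torus_char k x)"
proof
  fix x
  have line: "torus_char k (x + t *\<^sub>R axis j 1)
      = torus_char k x * exp (2 * of_real pi * \<i> * of_int (k $ j) * of_real t)"
    for k :: "int ^ 'd" and t
    by (simp add: torus_char_def inner_add_right inner_axis real_vec_def distrib_left exp_add mult_ac)
  have "((\<lambda>t. \<Sum>k\<in>K. a k * torus_char k (x + t *\<^sub>R axis j 1)) has_vector_derivative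
      (\<Sum>k\<in>K. 2 * of_real pi * \<i> * of_int (k $ j) * a k * torus_char k x)) (at 0)"
    unfolding line
  proof (rule has_vector_derivative_sum)
    fix k
    let ?w = "2 * of_real pi * \<i> * of_int (k $ j) :: complex"
    have "((\<lambda>z. a k * (torus_char k x * exp (?w * z))) has_field_derivative
        ?w * a k * torus_char k x) (at (of_real 0))"
      by (auto intro!: derivative_eq_intros)
    from has_vector_derivative_real_field[OF this]
    show "((\<lambda>t. a k * (torus_char k x * exp (?w * of_real t))) has_vector_derivative
        ?w * a k * torus_char k x) (at 0)" .
  qed
  then show "partial_deriv j (\<lambda>x. \<Sum>k\<in>K. a k * torus_char k x) x
      = (\<Sum>k\<in>K. 2 * of_real pi * \<i> * of_int (k $ j) * a k * torus_char k x)"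
    unfolding partial_deriv_def by (rule vector_derivative_at)
qed

text \<open>Differentiation brings down 2 pi i k_j, and i / (2 pi) times 2 pi i is -1, so
  \<open>op_B\<close> is the Fourier multiplier -<L, k>.\<close>

lemma op_B_trig_sum:
  fixes L :: "int ^ 'd"
  shows "op_B L (\<lambda>x. \<Sum>k\<in>K. a k * torus_char k x)
    = (\<lambda>x. \<Sum>k\<in>K. - of_int (\<Sum>j\<in>UNIV. L $ j * k $ j) * a k * torus_char k x)"
proof
  fix x
  have "op_B L (\<lambda>x. \<Sum>k\<in>K. a k * torus_char k x) x
      = (\<Sum>j\<in>UNIV. \<Sum>k\<in>K. - of_int (L $ j * k $ j) * a k * torus_char k x)"
    by (simp add: op_B_def partial_deriv_trig_sum sum_distrib_left sum_negf field_simps)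
  also have "\<dots> = (\<Sum>k\<in>K. \<Sum>j\<in>UNIV. - of_int (L $ j * k $ j) * a k * torus_char k x)"
    by (rule sum.swap)
  finally show "op_B L (\<lambda>x. \<Sum>k\<in>K. a k * torus_char k x) x
      = (\<Sum>k\<in>K. - of_int (\<Sum>j\<in>UNIV. L $ j * k $ j) * a k * torus_char k x)"
    by (simp add: sum_distrib_right sum_negf)
qed

subsection \<open>Growth of sequences and of double sums\<close>

text \<open>From some index on, the increments of \<open>w\<close> are at most e/2 times those of
  \<open>v\<close>. Telescoping carries this bound over to \<open>w\<close> itself, up to a constant
  that the divergence of \<open>v\<close> absorbs.\<close>

lemma stolz_cesaro_zero:
  fixes w v :: "nat \<Rightarrow> real"
  assumes mono: "\<And>n. v n < v (Suc n)"
    and v: "filterlim v at_top sequentially"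
    and lim: "(\<lambda>n. (w (Suc n) - w n) / (v (Suc n) - v n)) \<longlonglongrightarrow> 0"
  shows "(\<lambda>n. w n / v n) \<longlonglongrightarrow> 0"
proof (rule LIMSEQ_I)
  fix e :: real
  assume e: "e > 0"
  obtain N where N: "\<And>n. n \<ge> N \<Longrightarrow> \<bar>(w (Suc n) - w n) / (v (Suc n) - v n)\<bar> < e / 2"
    using LIMSEQ_D[OF lim, of "e / 2"] e by auto
  have step: "\<bar>w (Suc n) - w n\<bar> \<le> e / 2 * (v (Suc n) - v n)" if "n \<ge> N" for n
    using N[OF that] mono[of n] by (simp add: abs_divide divide_less_eq)
  have acc: "\<bar>w n - w N\<bar> \<le> e / 2 * (v n - v N)" if "n \<ge> N" for n
    using that
  proof (induction n rule: dec_induct)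
    case (step n)
    have "\<bar>w (Suc n) - w N\<bar> \<le> \<bar>w (Suc n) - w n\<bar> + \<bar>w n - w N\<bar>"
      by simp
    also have "\<dots> \<le> e / 2 * (v (Suc n) - v n) + e / 2 * (v n - v N)"
      using step \<open>\<And>n. n \<ge> N \<Longrightarrow> \<bar>w (Suc n) - w n\<bar> \<le> e / 2 * (v (Suc n) - v n)\<close>
      by (intro add_mono) auto
    finally show ?case
      by (simp add: field_simps)
  qed simp
  \<comment> \<open>\<open>C\<close> collects the contributions of the starting index
    \<open>N\<close>; once \<open>v n\<close> exceeds 2 C / e, they amount to less than e/2 times
    \<open>v n\<close>.\<close>
  define C where "C = \<bar>w N\<bar> + e / 2 * \<bar>v N\<bar>"
  have "eventually (\<lambda>n. v n > 2 * C / e + 1) sequentially"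
    using v by (rule filterlim_at_top_dense[THEN iffD1, rule_format])
  then obtain M where M: "\<And>n. n \<ge> M \<Longrightarrow> v n > 2 * C / e + 1"
    by (auto simp: eventually_sequentially)
  show "\<exists>M. \<forall>n\<ge>M. norm (w n / v n - 0) < e"
  proof (intro exI allI impI)
    fix n
    assume n: "n \<ge> max M N"
    have C: "C \<ge> 0"
      using e by (simp add: C_def)
    have vn: "v n > 2 * C / e + 1"
      using M n by simp
    moreover have "2 * C / e \<ge> 0"
      using C e by simp
    ultimately have pos: "v n > 0"
      by linarith
    have "2 * C / e < v n"
      using vn by linarith
    then have "C < e / 2 * v n"
      using e by (simp add: field_simps)
    moreover have "\<bar>w n\<bar> \<le> C + e / 2 * v n"
    proof -
      have "\<bar>w n\<bar> \<le> \<bar>w n - w N\<bar> + \<bar>w N\<bar>"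
        by simp
      also have "\<bar>w n - w N\<bar> \<le> e / 2 * (v n - v N)"
        using acc n by simp
      also have "\<dots> \<le> e / 2 * (v n + \<bar>v N\<bar>)"
        using e by (intro mult_left_mono) auto
      finally show ?thesis
        by (simp add: C_def algebra_simps)
    qed
    ultimately have "\<bar>w n\<bar> < e * v n"
      by linarith
    then show "norm (w n / v n - 0) < e"
      using pos by (simp add: abs_divide divide_less_eq)
  qed
qed

text \<open>Subtracting l times \<open>v\<close> from \<open>u\<close> reduces to limit
  zero.\<close>

lemma stolz_cesaro:
  fixes u v :: "nat \<Rightarrow> real"
  assumes mono: "\<And>n. v n < v (Suc n)"
    and v: "filterlim v at_top sequentially"
    and lim: "(\<lambda>n. (u (Suc n) - u n) / (v (Suc n) - v n)) \<longlonglongrightarrow> l"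
  shows "(\<lambda>n. u n / v n) \<longlonglongrightarrow> l"
proof -
  have "(\<lambda>n. (u n - l * v n) / v n) \<longlonglongrightarrow> 0"
  proof (rule stolz_cesaro_zero[OF mono v])
    have "((u (Suc n) - l * v (Suc n)) - (u n - l * v n)) / (v (Suc n) - v n)
        = (u (Suc n) - u n) / (v (Suc n) - v n) - l" for n
      using mono[of n] by (simp add: field_simps)
    then show "(\<lambda>n. ((u (Suc n) - l * v (Suc n)) - (u n - l * v n)) / (v (Suc n) - v n)) \<longlonglongrightarrow> 0"
      using tendsto_diff[OF lim tendsto_const[of l]] by simp
  qed
  then have "(\<lambda>n. (u n - l * v n) / v n + l) \<longlonglongrightarrow> 0 + l"
    by (intro tendsto_intros)
  moreover have "eventually (\<lambda>n. (u n - l * v n) / v n + l = u n / v n) sequentially"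
    using filterlim_at_top_dense[THEN iffD1, rule_format, OF v, of 0]
    by eventually_elim (simp add: field_simps)
  ultimately have "(\<lambda>n. u n / v n) \<longlonglongrightarrow> 0 + l"
    by (rule Lim_transform_eventually)
  then show ?thesis
    by simp
qed

lemma tendsto_shift_ratio: "(\<lambda>n. (real n + c) / real n) \<longlonglongrightarrow> 1"
proof -
  have "(\<lambda>n. 1 + c / real n) \<longlonglongrightarrow> 1 + 0"
    by (intro tendsto_intros lim_const_over_n)
  moreover have "eventually (\<lambda>n. 1 + c / real n = (real n + c) / real n) sequentially"
    using eventually_gt_at_top[of 0] by eventually_elim (simp add: field_simps)
  ultimately have "(\<lambda>n. (real n + c) / real n) \<longlonglongrightarrow> 1 + 0"
    by (rule Lim_transform_eventually)
  then show ?thesis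
    by simp
qed

text \<open>The difference of powers factors into p + 1 products of p factors \<open>n\<close> or
  \<open>Suc n\<close>; divided by n^p, each of them tends to 1.\<close>

lemma power_increment_limit:
  "(\<lambda>n. (real (Suc n) ^ Suc p - real n ^ Suc p) / real n ^ p) \<longlonglongrightarrow> real (Suc p)"
proof -
  have "(\<lambda>n. \<Sum>i<Suc p. ((real n + 1) / real n) ^ i) \<longlonglongrightarrow> (\<Sum>i<Suc p. 1 ^ i)"
    by (intro tendsto_sum tendsto_power tendsto_shift_ratio)
  moreover have "eventually (\<lambda>n. (\<Sum>i<Suc p. ((real n + 1) / real n) ^ i)
      = (real (Suc n) ^ Suc p - real n ^ Suc p) / real n ^ p) sequentially"
    using eventually_gt_at_top[of 0]
  proof eventually_elim
    case (elim n)
    have "real (Suc n) ^ Suc p - real n ^ Suc p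
        = (\<Sum>i<Suc p. real n ^ (Suc p - Suc i) * real (Suc n) ^ i)"
      by (subst power_diff_sumr2) simp
    also have "\<dots> / real n ^ p = (\<Sum>i<Suc p. ((real n + 1) / real n) ^ i)"
      unfolding sum_divide_distrib
    proof (rule sum.cong)
      fix i assume "i \<in> {..<Suc p}"
      then have "real n ^ p = real n ^ (p - i) * real n ^ i"
        by (simp flip: power_add)
      then show "real n ^ (Suc p - Suc i) * real (Suc n) ^ i / real n ^ p = ((real n + 1) / real n) ^ i"
        using elim by (simp add: power_divide add.commute)
    qed simp
    finally show ?case ..
  qed
  ultimately have "(\<lambda>n. (real (Suc n) ^ Suc p - real n ^ Suc p) / real n ^ p) \<longlonglongrightarrow> (\<Sum>i<Suc p. 1 ^ i)"
    by (rule Lim_transform_eventually)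
  then show ?thesis
    by simp
qed

text \<open>Stolz-Cesaro against n^(p+1): the discrete counterpart of integrating c x^p.\<close>

lemma power_growth_of_increments:
  fixes u :: "nat \<Rightarrow> real"
  assumes "(\<lambda>n. (u (Suc n) - u n) / real n ^ p) \<longlonglongrightarrow> c"
  shows "(\<lambda>n. u n / real n ^ Suc p) \<longlonglongrightarrow> c / real (Suc p)"
proof (rule stolz_cesaro)
  show "real n ^ Suc p < real (Suc n) ^ Suc p" for n
    by (intro power_strict_mono) auto
  show "filterlim (\<lambda>n. real n ^ Suc p) at_top sequentially"
    by (intro filterlim_pow_at_top filterlim_real_sequentially) simp
  let ?D = "\<lambda>n. real (Suc n) ^ Suc p - real n ^ Suc p"
  have "(\<lambda>n. ((u (Suc n) - u n) / real n ^ p) / (?D n / real n ^ p)) \<longlonglongrightarrow> c / real (Suc p)"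
    by (intro tendsto_divide assms power_increment_limit) simp
  moreover have "eventually (\<lambda>n. ((u (Suc n) - u n) / real n ^ p) / (?D n / real n ^ p)
      = (u (Suc n) - u n) / ?D n) sequentially"
    using eventually_gt_at_top[of 0] by eventually_elim simp
  ultimately show "(\<lambda>n. (u (Suc n) - u n) / ?D n) \<longlonglongrightarrow> c / real (Suc p)"
    by (rule Lim_transform_eventually)
qed

section \<open>Double sums over growing index squares\<close>

lemma sum_square_Suc_diff:
  fixes G :: "nat \<Rightarrow> nat \<Rightarrow> real"
  assumes "\<And>r s. G r s = G s r"
  shows "(\<Sum>r<Suc n. \<Sum>s<Suc n. G r s) - (\<Sum>r<n. \<Sum>s<n. G r s) = G n n + 2 * (\<Sum>s<n. G s n)"
  using assms by (simp add: sum.distrib)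

text \<open>Enlarging the square adds the corner \<open>W n\<close> and two copies of the partial
  sum of \<open>W\<close>. Integrating growth once for the partial sum and once for the double sum
  yields the divisors p + 1 and p + 2; the corner is of lower order.\<close>

lemma double_sum_min_growth:
  fixes W :: "nat \<Rightarrow> real"
  assumes W: "(\<lambda>n. W n / real n ^ p) \<longlonglongrightarrow> c"
  shows "(\<lambda>n. (\<Sum>r<n. \<Sum>s<n. W (min r s)) / real n ^ (p + 2))
    \<longlonglongrightarrow> 2 * c / ((real p + 1) * (real p + 2))"
proof -
  let ?V = "\<lambda>n. \<Sum>s<n. W s"
  have V: "(\<lambda>n. ?V n / real n ^ Suc p) \<longlonglongrightarrow> c / real (Suc p)"
    using W by (intro power_growth_of_increments) simp
  have W0: "(\<lambda>n. W n / real n ^ Suc p) \<longlonglongrightarrow> 0"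
  proof -
    have "(\<lambda>n. (W n / real n ^ p) * (1 / real n)) \<longlonglongrightarrow> c * 0"
      by (intro tendsto_mult W lim_const_over_n)
    then show ?thesis
      by (simp add: mult.commute)
  qed
  have "(\<lambda>n. W n / real n ^ Suc p + 2 * (?V n / real n ^ Suc p)) \<longlonglongrightarrow> 0 + 2 * (c / real (Suc p))"
    by (intro tendsto_intros W0 V)
  moreover have "(\<Sum>r<Suc n. \<Sum>s<Suc n. W (min r s)) - (\<Sum>r<n. \<Sum>s<n. W (min r s)) = W n + 2 * ?V n" for n
    by (subst sum_square_Suc_diff) (simp_all add: min.commute)
  ultimately have "(\<lambda>n. ((\<Sum>r<Suc n. \<Sum>s<Suc n. W (min r s)) - (\<Sum>r<n. \<Sum>s<n. W (min r s)))
      / real n ^ Suc p) \<longlonglongrightarrow> 2 * (c / real (Suc p))"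
    by (simp only: add_divide_distrib times_divide_eq_right add_0_left)
  from power_growth_of_increments[OF this] show ?thesis
    by (simp add: field_simps)
qed

text \<open>Only the band \<open>\<bar>r - s\<bar> \<le> l\<close> contributes, so the growth exponent rises by one instead of
  two.\<close>

lemma double_sum_band_growth:
  fixes G :: "nat \<Rightarrow> nat \<Rightarrow> real"
  assumes sym: "\<And>r s. G r s = G s r"
    and band: "\<And>m t. t > l \<Longrightarrow> G m (m + t) = 0"
    and G: "\<And>t. (\<lambda>m. G m (m + t) / real m ^ p) \<longlonglongrightarrow> c t"
  shows "(\<lambda>n. (\<Sum>r<n. \<Sum>s<n. G r s) / real n ^ Suc p)
    \<longlonglongrightarrow> (c 0 + 2 * (\<Sum>t=1..l. c t)) / real (Suc p)"
proof (rule power_growth_of_increments)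
  \<comment> \<open>Assumption \<open>G\<close> is normalised by the smaller index m, but the
    increment at n has n as the larger one. Substituting m = n - t changes the normalisation only by
    a ratio tending to 1.\<close>
  have shifted: "(\<lambda>n. G (n - t) n / real n ^ p) \<longlonglongrightarrow> c t" for t
  proof -
    have "(\<lambda>m. G m (m + t) / real m ^ p * (1 / ((real m + real t) / real m) ^ p)) \<longlonglongrightarrow> c t * (1 / 1 ^ p)"
      by (intro tendsto_intros G tendsto_shift_ratio) simp
    moreover have "eventually (\<lambda>m. G m (m + t) / real m ^ p * (1 / ((real m + real t) / real m) ^ p)
        = G m (m + t) / real (m + t) ^ p) sequentially"
      using eventually_gt_at_top[of 0] by eventually_elim (simp add: power_divide)
    ultimately have "(\<lambda>m. G m (m + t) / real (m + t) ^ p) \<longlonglongrightarrow> c t * (1 / 1 ^ p)"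
      by (rule Lim_transform_eventually)
    then have "(\<lambda>m. G (m + t - t) (m + t) / real (m + t) ^ p) \<longlonglongrightarrow> c t"
      by simp
    then show ?thesis
      by (rule LIMSEQ_offset[where f = "\<lambda>n. G (n - t) n / real n ^ p"])
  qed
  have "(\<lambda>n. G (n - 0) n / real n ^ p + 2 * (\<Sum>t=1..l. G (n - t) n / real n ^ p))
      \<longlonglongrightarrow> c 0 + 2 * (\<Sum>t=1..l. c t)"
    by (intro tendsto_intros shifted)
  moreover have "eventually (\<lambda>n. G (n - 0) n / real n ^ p + 2 * (\<Sum>t=1..l. G (n - t) n / real n ^ p)
      = ((\<Sum>r<Suc n. \<Sum>s<Suc n. G r s) - (\<Sum>r<n. \<Sum>s<n. G r s)) / real n ^ p) sequentially"
    using eventually_ge_at_top[of l]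
  proof eventually_elim
    case (elim n)
    \<comment> \<open>Entries farther than \<open>l\<close> from the diagonal vanish, and the
      remaining ones are indexed by their distance t = n - s. The bound \<open>l\<close> <= n keeps
      n - t from being truncated.\<close>
    have "(\<Sum>s<n. G s n) = (\<Sum>s\<in>{n - l..<n}. G s n)"
    proof (rule sum.mono_neutral_right)
      show "\<forall>s\<in>{..<n} - {n - l..<n}. G s n = 0"
      proof
        fix s assume "s \<in> {..<n} - {n - l..<n}"
        then show "G s n = 0"
          using band[of "n - s" s] by auto
      qed
    qed auto
    also have "\<dots> = (\<Sum>t=1..l. G (n - t) n)"
      using elim by (intro sum.reindex_bij_witness[of _ "\<lambda>t. n - t" "\<lambda>s. n - s"]) auto
    finally show ?case
      unfolding sum_square_Suc_diff[of G, OF sym]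
      by (simp add: add_divide_distrib flip: sum_divide_distrib)
  qed
  ultimately show "(\<lambda>n. ((\<Sum>r<Suc n. \<Sum>s<Suc n. G r s) - (\<Sum>r<n. \<Sum>s<n. G r s)) / real n ^ p)
      \<longlonglongrightarrow> c 0 + 2 * (\<Sum>t=1..l. c t)"
    by (rule Lim_transform_eventually)
qed

subsection \<open>Lattice points in cubes\<close>

definition lattice_cube :: "nat \<Rightarrow> (int ^ 'd) set" where
  "lattice_cube r = {k. \<forall>j. k $ j \<in> {- int r..int r}}"

text \<open>Distributivity, with vectors in a box identified with choice functions. It reduces
  counts and moments of boxes to single coordinates.\<close>

lemma sum_prod_lattice_box:
  fixes f :: "'d :: finite \<Rightarrow> int \<Rightarrow> real"
  assumes "\<And>j. finite (S j)"
  shows "(\<Sum>k | \<forall>j. k $ j \<in> S j. \<Prod>j\<in>UNIV. f j (k $ j)) = (\<Prod>j\<in>UNIV. \<Sum>y\<in>S j. f j y)"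
proof -
  have "(\<Prod>j\<in>UNIV. \<Sum>y\<in>S j. f j y) = (\<Sum>g\<in>Pi\<^sub>E UNIV S. \<Prod>j\<in>UNIV. f j (g j))"
    by (rule prod_sum_PiE) (use assms in auto)
  also have "\<dots> = (\<Sum>k | \<forall>j. k $ j \<in> S j. \<Prod>j\<in>UNIV. f j (k $ j))"
    by (rule sum.reindex_bij_witness[of _ "\<lambda>k. vec_nth k" "\<lambda>g. \<chi> j. g j"]) (auto simp: PiE_iff)
  finally show ?thesis ..
qed

lemma card_lattice_box:
  fixes S :: "'d :: finite \<Rightarrow> int set"
  assumes "\<And>j. finite (S j)"
  shows "real (card {k. \<forall>j. k $ j \<in> S j}) = (\<Prod>j\<in>UNIV. real (card (S j)))"
  using sum_prod_lattice_box[OF assms, of "\<lambda>_ _. 1"] by simp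

lemma card_lattice_cube: "real (card (lattice_cube r :: (int ^ 'd) set)) = (2 * real r + 1) ^ CARD('d)"
  unfolding lattice_cube_def by (subst card_lattice_box) (simp_all add: algebra_simps)

lemma symmetric_interval_Suc:
  "{- int (Suc r)..int (Suc r)} = insert (- int (Suc r)) (insert (int (Suc r)) {- int r..int r})"
  by auto

lemma sum_symmetric_interval: "(\<Sum>y\<in>{- int r..int r}. real_of_int y) = 0"
  by (induction r) (simp, subst symmetric_interval_Suc, simp)

text \<open>The factor 2 r + 1 is kept apart so that the product over the coordinates collects into
  (2 r + 1)^d.\<close>

lemma sum_squares_symmetric_interval:
  "(\<Sum>y\<in>{- int r..int r}. (real_of_int y)\<^sup>2) = (2 * real r + 1) * (real r * (real r + 1) / 3)"
proof (induction r)
  case (Suc r)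
  then show ?case
    by (subst symmetric_interval_Suc) (simp add: field_simps power2_eq_square)
qed simp

lemma second_moment_lattice_cube:
  fixes i j :: "'d :: finite"
  shows "(\<Sum>k\<in>lattice_cube r. real_of_int (k $ i) * real_of_int (k $ j))
    = (if i = j then (2 * real r + 1) ^ CARD('d) * (real r * (real r + 1) / 3) else 0)"
proof -
  \<comment> \<open>The weight k_i k_j as a product over all coordinates. For i = j both factors
    fall on one coordinate and give a square; otherwise coordinate i carries an odd summand and its
    sum vanishes.\<close>
  define f :: "'d \<Rightarrow> int \<Rightarrow> real" where
    "f = (\<lambda>x y. (if x = i then of_int y else 1) * (if x = j then of_int y else 1))"
  have "(\<Sum>k\<in>lattice_cube r. real_of_int (k $ i) * real_of_int (k $ j))
      = (\<Sum>k\<in>lattice_cube r. \<Prod>x\<in>UNIV. f x (k $ x))"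
    by (simp add: f_def prod.distrib)
  also have "\<dots> = (\<Prod>x\<in>UNIV. \<Sum>y\<in>{- int r..int r}. f x y)"
    unfolding lattice_cube_def by (rule sum_prod_lattice_box) simp
  also have "\<dots> = (if i = j then (2 * real r + 1) ^ CARD('d) * (real r * (real r + 1) / 3) else 0)"
  proof (cases "i = j")
    case True
    have "(\<Sum>y\<in>{- int r..int r}. f x y)
        = (2 * real r + 1) * (if x = i then real r * (real r + 1) / 3 else 1)" for x
      using sum_squares_symmetric_interval[of r] True
      by (simp add: f_def power2_eq_square)
    then show ?thesis
      using True by (simp add: prod.distrib)
  next
    case False
    then have "(\<Sum>y\<in>{- int r..int r}. f i y) = 0"
      using sum_symmetric_interval[of r] by (simp add: f_def)
    then show ?thesis
      using False by (auto simp: prod_zero_iff)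
  qed
  finally show ?thesis .
qed

text \<open>Expanding the square leaves only the diagonal, since mixed second moments of a cube
  vanish; this is how ||L||^2 enters the second factor of the product.\<close>

lemma sum_square_linear_form_lattice_cube:
  fixes L :: "int ^ 'd"
  shows "(\<Sum>k\<in>lattice_cube r. (real_of_int (\<Sum>j\<in>UNIV. L $ j * k $ j))\<^sup>2)
    = (\<Sum>j\<in>UNIV. (real_of_int (L $ j))\<^sup>2) * ((2 * real r + 1) ^ CARD('d) * (real r * (real r + 1) / 3))"
proof -
  let ?L = "\<lambda>j. real_of_int (L $ j)"
  have "(\<Sum>k\<in>lattice_cube r. (real_of_int (\<Sum>j\<in>UNIV. L $ j * k $ j))\<^sup>2)
      = (\<Sum>k\<in>lattice_cube r. \<Sum>i\<in>UNIV. \<Sum>j\<in>UNIV. ?L i * ?L j * (real_of_int (k $ i) * real_of_int (k $ j)))"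
    by (simp add: power2_eq_square sum_product mult_ac)
  also have "\<dots> = (\<Sum>i\<in>UNIV. \<Sum>k\<in>lattice_cube r. \<Sum>j\<in>UNIV. ?L i * ?L j * (real_of_int (k $ i) * real_of_int (k $ j)))"
    by (rule sum.swap)
  also have "\<dots> = (\<Sum>i\<in>UNIV. \<Sum>j\<in>UNIV. \<Sum>k\<in>lattice_cube r. ?L i * ?L j * (real_of_int (k $ i) * real_of_int (k $ j)))"
    by (intro sum.cong refl sum.swap)
  also have "\<dots> = (\<Sum>i\<in>UNIV. \<Sum>j\<in>UNIV. if i = j
      then (?L i)\<^sup>2 * ((2 * real r + 1) ^ CARD('d) * (real r * (real r + 1) / 3)) else 0)"
    unfolding sum_distrib_left[symmetric] second_moment_lattice_cube
    by (intro sum.cong refl) (simp add: power2_eq_square)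
  finally show ?thesis
    by (simp add: sum_distrib_right)
qed

section \<open>Overlaps of a cube with a translated cube\<close>

definition cube_overlap :: "int ^ 'd \<Rightarrow> nat \<Rightarrow> nat \<Rightarrow> (int ^ 'd) set" where
  "cube_overlap L r s = {k \<in> lattice_cube r. k + L \<in> lattice_cube s}"

lemma cube_overlap_zero: "cube_overlap 0 r s = (lattice_cube (min r s) :: (int ^ 'd) set)"
proof -
  have "k \<in> lattice_cube r \<and> k \<in> lattice_cube s \<longleftrightarrow> k \<in> lattice_cube (min r s)" for k :: "int ^ 'd"
    unfolding lattice_cube_def by (simp add: of_nat_min) (smt (verit))
  then show ?thesis
    by (auto simp: cube_overlap_def)
qed

text \<open>The reflection k -> -k - L is an involution exchanging the conditions on k and on k + L,
  because the cubes are symmetric about 0.\<close>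

lemma card_cube_overlap_commute:
  fixes L :: "int ^ 'd"
  shows "card (cube_overlap L r s) = card (cube_overlap L s r)"
proof (rule bij_betw_same_card)
  show "bij_betw (\<lambda>k. - k - L) (cube_overlap L r s) (cube_overlap L s r)"
    by (rule bij_betwI[where g = "\<lambda>k. - k - L"])
      (auto simp: cube_overlap_def lattice_cube_def, (smt (verit))+)
qed

text \<open>A radius surplus \<open>t\<close> of at least every |L_j| swallows the translation, so
  the overlap is the same as for L = 0. This confines the defect to a band around the
  diagonal.\<close>

lemma cube_overlap_eq_cube:
  fixes L :: "int ^ 'd"
  assumes "\<And>j. nat \<bar>L $ j\<bar> \<le> t"
  shows "cube_overlap L m (m + t) = lattice_cube m"
proof -
  have "- int (m + t) \<le> k $ j + L $ j \<and> k $ j + L $ j \<le> int (m + t)"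
    if "- int m \<le> k $ j \<and> k $ j \<le> int m" for k j
    using that assms[of j] by simp linarith
  then show ?thesis
    by (auto simp: cube_overlap_def lattice_cube_def)
qed

text \<open>The overlap is a box, and its side j loses max(0, |L_j| - t) of the 2 m + 1 points,
  which the truncated subtraction expresses. The lower bound on \<open>m\<close> ensures that no
  side is empty.\<close>

lemma card_cube_overlap:
  fixes L :: "int ^ 'd"
  assumes "\<And>j. nat \<bar>L $ j\<bar> \<le> m"
  shows "real (card (cube_overlap L m (m + t)))
    = (\<Prod>j\<in>UNIV. 2 * real m + 1 - real (nat \<bar>L $ j\<bar> - t))"
proof -
  let ?S = "\<lambda>j. {max (- int m) (- int (m + t) - L $ j)..min (int m) (int (m + t) - L $ j)}"
  have "cube_overlap L m (m + t) = {k. \<forall>j. k $ j \<in> ?S j}"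
    by (auto simp: cube_overlap_def lattice_cube_def algebra_simps)
  moreover have "real (card (?S j)) = 2 * real m + 1 - real (nat \<bar>L $ j\<bar> - t)" for j
  proof -
    have "card (?S j) = 2 * m + 1 - (nat \<bar>L $ j\<bar> - t)"
      using assms[of j] by (simp add: max_def min_def nat_eq_iff)
    moreover have "nat \<bar>L $ j\<bar> - t \<le> 2 * m + 1"
      using assms[of j] by simp
    ultimately show ?thesis
      by (simp add: of_nat_diff)
  qed
  ultimately show ?thesis
    by (simp only: card_lattice_box finite_atLeastAtMost_int)
qed

text \<open>First-order expansion of the product in 1/N. In the induction, a new factor 1 - b_i/N
  next to a product P turns N (1 - P) into N (1 - P) + b_i P, and P tends to 1.\<close>

lemma tendsto_first_variation_prod:
  fixes b :: "'j \<Rightarrow> real"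
  assumes "finite J" and N: "filterlim N at_top F"
  shows "((\<lambda>x. N x * (1 - (\<Prod>j\<in>J. 1 - b j / N x))) \<longlongrightarrow> (\<Sum>j\<in>J. b j)) F"
  using assms(1)
proof (induction J rule: finite_induct)
  case (insert i J)
  have small: "((\<lambda>x. b j / N x) \<longlongrightarrow> 0) F" for j
    by (rule tendsto_divide_0[OF tendsto_const filterlim_at_top_imp_at_infinity[OF N]])
  have "((\<lambda>x. N x * (1 - (\<Prod>j\<in>J. 1 - b j / N x)) + b i * (\<Prod>j\<in>J. 1 - b j / N x))
      \<longlongrightarrow> (\<Sum>j\<in>J. b j) + b i * (\<Prod>j\<in>J. 1 - 0)) F"
    by (intro tendsto_intros small insert.IH)
  moreover have "eventually (\<lambda>x. N x * (1 - (\<Prod>j\<in>J. 1 - b j / N x)) + b i * (\<Prod>j\<in>J. 1 - b j / N x)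
      = N x * (1 - (\<Prod>j\<in>insert i J. 1 - b j / N x))) F"
    using filterlim_at_top_dense[THEN iffD1, rule_format, OF N, of 0]
    by eventually_elim (use insert.hyps in \<open>simp add: field_simps\<close>)
  ultimately have "((\<lambda>x. N x * (1 - (\<Prod>j\<in>insert i J. 1 - b j / N x)))
      \<longlongrightarrow> (\<Sum>j\<in>J. b j) + b i * (\<Prod>j\<in>J. 1 - 0)) F"
    by (rule Lim_transform_eventually)
  then show ?case
    using insert.hyps by (simp add: add.commute)
qed simp

lemma tendsto_two_plus_inverse: "(\<lambda>n. (2 * real n + 1) / real n) \<longlonglongrightarrow> 2"
proof -
  have "(\<lambda>n. 1 + (real n + 1) / real n) \<longlonglongrightarrow> 1 + 1"
    by (intro tendsto_intros tendsto_shift_ratio)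
  moreover have "eventually (\<lambda>n. 1 + (real n + 1) / real n = (2 * real n + 1) / real n) sequentially"
    using eventually_gt_at_top[of 0] by eventually_elim (simp add: field_simps)
  ultimately have "(\<lambda>n. (2 * real n + 1) / real n) \<longlonglongrightarrow> 1 + 1"
    by (rule Lim_transform_eventually)
  then show ?thesis
    by simp
qed

text \<open>Factoring out (2 m + 1)^d leaves the first variation of a product. The leading terms
  cancel, so the defect has order m^(d-1).\<close>

lemma cube_overlap_defect_limit:
  fixes L :: "int ^ 'd"
  shows "(\<lambda>m. ((2 * real m + 1) ^ CARD('d) - real (card (cube_overlap L m (m + t)))) / real m ^ (CARD('d) - 1))
    \<longlonglongrightarrow> 2 ^ (CARD('d) - 1) * (\<Sum>j\<in>UNIV. real (nat \<bar>L $ j\<bar> - t))"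
proof -
  let ?b = "\<lambda>j. real (nat \<bar>L $ j\<bar> - t)" and ?N = "\<lambda>m. 2 * real m + 1"
  have N: "filterlim ?N at_top sequentially"
    by (rule filterlim_at_top_mono[OF filterlim_real_sequentially]) simp
  have "(\<lambda>m. (?N m / real m) ^ (CARD('d) - 1) * (?N m * (1 - (\<Prod>j\<in>UNIV. 1 - ?b j / ?N m))))
      \<longlonglongrightarrow> 2 ^ (CARD('d) - 1) * (\<Sum>j\<in>UNIV. ?b j)"
    by (intro tendsto_mult tendsto_power tendsto_two_plus_inverse tendsto_first_variation_prod N) simp
  moreover have "eventually (\<lambda>m. (?N m / real m) ^ (CARD('d) - 1) * (?N m * (1 - (\<Prod>j\<in>UNIV. 1 - ?b j / ?N m)))
      = (?N m ^ CARD('d) - real (card (cube_overlap L m (m + t)))) / real m ^ (CARD('d) - 1)) sequentially"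
    using eventually_ge_at_top[of "\<Sum>j\<in>UNIV. nat \<bar>L $ j\<bar>"]
  proof eventually_elim
    case (elim m)
    have "nat \<bar>L $ j\<bar> \<le> m" for j
      using elim member_le_sum[of j UNIV "\<lambda>j. nat \<bar>L $ j\<bar>"] by simp
    then have "real (card (cube_overlap L m (m + t))) = (\<Prod>j\<in>UNIV. ?N m * (1 - ?b j / ?N m))"
      by (subst card_cube_overlap) (auto intro!: prod.cong simp: field_simps)
    then have "real (card (cube_overlap L m (m + t))) = ?N m ^ CARD('d) * (\<Prod>j\<in>UNIV. 1 - ?b j / ?N m)"
      by (simp only: prod.distrib prod_constant)
    then have "?N m ^ CARD('d) - real (card (cube_overlap L m (m + t)))
        = ?N m ^ CARD('d) * (1 - (\<Prod>j\<in>UNIV. 1 - ?b j / ?N m))"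
      by (simp only: right_diff_distrib mult_1_right)
    moreover have "?N m ^ CARD('d) = ?N m ^ (CARD('d) - 1) * ?N m"
      by (metis power_minus_mult zero_less_card_finite)
    ultimately show ?case
      by (simp add: power_divide)
  qed
  ultimately show ?thesis
    by (rule Lim_transform_eventually)
qed

text \<open>Raising \<open>a\<close> by one adds 1 to each summand with t <= a, so the left side
  grows by 2 a + 1. With a = |L_j| this turns the sum over the band into ||L||^2.\<close>

lemma sum_truncated_diff_eq_square:
  "a \<le> l \<Longrightarrow> real a + 2 * (\<Sum>t=1..l. real (a - t)) = (real a)\<^sup>2"
proof (induction a)
  case (Suc a)
  have "(\<Sum>t=1..l. real (Suc a - t)) = (\<Sum>t=1..l. real (a - t) + of_bool (t \<le> a))"
    by (intro sum.cong) (auto simp: of_nat_diff)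
  also have "\<dots> = (\<Sum>t=1..l. real (a - t)) + real (card ({1..l} \<inter> {t. t \<le> a}))"
    by (simp add: sum.distrib of_bool_def sum.If_cases)
  also have "{1..l} \<inter> {t. t \<le> a} = {1..a}"
    using Suc.prems by auto
  finally show ?case
    using Suc by (simp add: power2_eq_square algebra_simps)
qed simp

subsection \<open>The Fejer kernel\<close>

text \<open>\<^term>\<open>tent n k\<close> is \<open>n\<close> times the Fourier coefficient of the Fejer kernel at \<open>k\<close>: the cubes of
  radius below \<open>n\<close> containing \<open>k\<close> are those of radius at least \<open>\<parallel>k\<parallel>\<^sub>\<infinity>\<close>.\<close>

definition tent :: "nat \<Rightarrow> int ^ 'd \<Rightarrow> real" where
  "tent n k = (\<Sum>r<n. of_bool (k \<in> lattice_cube r))"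

definition fejer_index :: "nat \<Rightarrow> (int ^ 'd) set" where
  "fejer_index n = {k. infnorm (real_vec k) < real n}"

lemma finite_fejer_index_set: "finite (fejer_index n)"
  unfolding fejer_index_def by (rule finite_fejer_index)

text \<open>The maximum norm of an integer vector is a natural number \<open>N\<close>. Both facts
  are obtained for the same \<open>N\<close>, linking the norm to membership in the cubes.\<close>

lemma infnorm_real_vec:
  fixes k :: "int ^ 'd"
  obtains N where "infnorm (real_vec k) = real N" "\<And>r. k \<in> lattice_cube r \<longleftrightarrow> N \<le> r"
proof
  let ?N = "Max (range (\<lambda>j. nat \<bar>k $ j\<bar>))"
  have "Sup {\<bar>real_vec k $ j\<bar> | j. j \<in> UNIV} = real ?N"
  proof (rule cSup_eq_maximum)
    have "?N \<in> range (\<lambda>j. nat \<bar>k $ j\<bar>)"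
      by (rule Max_in) auto
    then obtain j where "?N = nat \<bar>k $ j\<bar>"
      by blast
    then show "real ?N \<in> {\<bar>real_vec k $ j\<bar> | j. j \<in> UNIV}"
      by (auto simp: real_vec_def)
  next
    fix y assume "y \<in> {\<bar>real_vec k $ j\<bar> | j. j \<in> UNIV}"
    then obtain j where "y = real (nat \<bar>k $ j\<bar>)"
      by (auto simp: real_vec_def)
    moreover have "nat \<bar>k $ j\<bar> \<le> ?N"
      by (rule Max_ge) auto
    ultimately show "y \<le> real ?N"
      by (simp only: of_nat_le_iff)
  qed
  then show "infnorm (real_vec k) = real ?N"
    by (simp add: infnorm_cart)
  show "k \<in> lattice_cube r \<longleftrightarrow> ?N \<le> r" for r
    by (auto simp: lattice_cube_def nat_le_iff abs_le_iff) (smt (verit))+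
qed

text \<open>The radii counted are N <= r < n; truncated subtraction also covers the value 0 off the
  index set.\<close>

lemma tent_eq:
  assumes "infnorm (real_vec k) = real N" "\<And>r. k \<in> lattice_cube r \<longleftrightarrow> N \<le> r"
  shows "tent n k = real (n - N)"
proof -
  have "tent n k = real (card ({..<n} \<inter> {r. N \<le> r}))"
    by (simp add: tent_def assms(2) of_bool_def sum.If_cases)
  also have "{..<n} \<inter> {r. N \<le> r} = {N..<n}"
    by auto
  finally show ?thesis
    by simp
qed

lemma fejer_kernel_eq:
  assumes "n > 0"
  shows "fejer_kernel n = (\<lambda>x. \<Sum>k\<in>fejer_index n. of_real (tent n k / real n) * torus_char k x)"
proof
  fix x :: "real ^ 'd"
  have "1 - infnorm (real_vec k) / real n = tent n k / real n" if "k \<in> fejer_index n" for k :: "int ^ 'd"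
  proof -
    obtain N where N: "infnorm (real_vec k) = real N" "\<And>r. k \<in> lattice_cube r \<longleftrightarrow> N \<le> r"
      using infnorm_real_vec[of k] by blast
    then show ?thesis
      using that assms by (simp add: tent_eq[OF N] fejer_index_def of_nat_diff field_simps)
  qed
  then show "fejer_kernel n x = (\<Sum>k\<in>fejer_index n. of_real (tent n k / real n) * torus_char k x)"
    unfolding fejer_kernel_def torus_char_def fejer_index_def by (intro sum.cong refl) simp
qed

lemma tent_outside:
  assumes "k \<notin> fejer_index n"
  shows "tent n k = 0"
proof -
  obtain N where N: "infnorm (real_vec k) = real N" "\<And>r. k \<in> lattice_cube r \<longleftrightarrow> N \<le> r"
    using infnorm_real_vec[of k] by blast
  then show ?thesis
    using assms by (simp add: tent_eq[OF N] fejer_index_def)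
qed

lemma lattice_cube_subset_fejer_index: "r < n \<Longrightarrow> lattice_cube r \<subseteq> fejer_index n"
proof
  fix k :: "int ^ 'd" assume "r < n" "k \<in> lattice_cube r"
  moreover obtain N where "infnorm (real_vec k) = real N" "\<And>r. k \<in> lattice_cube r \<longleftrightarrow> N \<le> r"
    using infnorm_real_vec[of k] by blast
  ultimately show "k \<in> fejer_index n"
    by (simp add: fejer_index_def)
qed

text \<open>Both tents are expanded into indicators of cubes and the sums exchanged. Weight 1 gives
  the inner products with F_n; the squared linear form with L = 0 gives the norm of B_L F_n.\<close>

lemma sum_tent_product:
  fixes L :: "int ^ 'd" and w :: "int ^ 'd \<Rightarrow> real"
  shows "(\<Sum>k\<in>fejer_index n. w k * (tent n k * tent n (k + L)))
    = (\<Sum>r<n. \<Sum>s<n. \<Sum>k\<in>cube_overlap L r s. w k)"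
proof -
  let ?g = "\<lambda>k r s. w k * (of_bool (k \<in> lattice_cube r) * of_bool (k + L \<in> lattice_cube s))"
  have "(\<Sum>k\<in>fejer_index n. w k * (tent n k * tent n (k + L)))
      = (\<Sum>k\<in>fejer_index n. \<Sum>r<n. \<Sum>s<n. ?g k r s)"
    by (simp only: tent_def sum_product) (simp only: sum_distrib_left)
  also have "\<dots> = (\<Sum>r<n. \<Sum>k\<in>fejer_index n. \<Sum>s<n. ?g k r s)"
    by (rule sum.swap)
  also have "\<dots> = (\<Sum>r<n. \<Sum>s<n. \<Sum>k\<in>fejer_index n. ?g k r s)"
    by (intro sum.cong refl sum.swap)
  also have "\<dots> = (\<Sum>r<n. \<Sum>s<n. \<Sum>k\<in>cube_overlap L r s. w k)"
  proof (rule sum.cong[OF refl], rule sum.cong[OF refl])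
    fix r s assume "r \<in> {..<n}"
    then have "cube_overlap L r s \<subseteq> fejer_index n"
      using lattice_cube_subset_fejer_index by (auto simp: cube_overlap_def)
    then show "(\<Sum>k\<in>fejer_index n. ?g k r s) = (\<Sum>k\<in>cube_overlap L r s. w k)"
      by (intro sum.mono_neutral_cong_right finite_fejer_index_set) (auto simp: cube_overlap_def)
  qed
  finally show ?thesis .
qed

section \<open>The uncertainty product in terms of lattice sums\<close>

definition overlap_sum :: "int ^ 'd \<Rightarrow> nat \<Rightarrow> real" where
  "overlap_sum L n = (\<Sum>r<n. \<Sum>s<n. real (card (cube_overlap L r s)))"

text \<open>For n > 0 this is n^2 ||B_L F_n||^2, just as \<open>overlap_sum L n\<close> is n^2 <A_L
  F_n, F_n> and, at L = 0, n^2 ||F_n||^2.\<close>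

definition moment_sum :: "int ^ 'd \<Rightarrow> nat \<Rightarrow> real" where
  "moment_sum L n = (\<Sum>r<n. \<Sum>s<n. \<Sum>k\<in>lattice_cube (min r s). (real_of_int (\<Sum>j\<in>UNIV. L $ j * k $ j))\<^sup>2)"

lemma sum_tent_shift: "(\<Sum>k\<in>fejer_index n. tent n k * tent n (k + L)) = overlap_sum L n"
  using sum_tent_product[of "\<lambda>_. 1" n L] by (simp add: overlap_sum_def)

lemma torus_inner_fejer:
  assumes "n > 0"
  shows "torus_inner (fejer_kernel n) (fejer_kernel n :: real ^ 'd \<Rightarrow> complex)
    = of_real (overlap_sum (0 :: int ^ 'd) n / (real n)\<^sup>2)"
proof -
  have "torus_inner (fejer_kernel n) (fejer_kernel n :: real ^ 'd \<Rightarrow> complex)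
      = of_real (\<Sum>k\<in>(fejer_index n :: (int ^ 'd) set). tent n k / real n * (tent n k / real n))"
    unfolding fejer_kernel_eq[OF assms]
    by (subst torus_inner_trig_sums) (simp_all add: finite_fejer_index_set)
  also have "(\<Sum>k\<in>(fejer_index n :: (int ^ 'd) set). tent n k / real n * (tent n k / real n))
      = overlap_sum (0 :: int ^ 'd) n / (real n)\<^sup>2"
    by (simp add: sum_tent_shift[symmetric] sum_divide_distrib power2_eq_square)
  finally show ?thesis .
qed

lemma torus_inner_op_A_fejer:
  fixes L :: "int ^ 'd"
  assumes "n > 0"
  shows "torus_inner (op_A L (fejer_kernel n)) (fejer_kernel n) = of_real (overlap_sum L n / (real n)\<^sup>2)"
proof -
  let ?c = "\<lambda>k. tent n k / real n"
  have "torus_inner (op_A L (fejer_kernel n)) (fejer_kernel n)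
      = (\<Sum>k\<in>fejer_index n. \<Sum>m\<in>fejer_index n. if k + L = m then of_real (?c k) * cnj (of_real (?c m)) else 0)"
    unfolding fejer_kernel_eq[OF assms] op_A_trig_sum
    by (rule torus_inner_trig_sums) (rule finite_fejer_index_set)+
  also have "\<dots> = of_real (\<Sum>k\<in>fejer_index n. ?c k * ?c (k + L))"
    by (simp add: finite_fejer_index_set) (intro sum.cong refl, simp add: tent_outside)
  also have "(\<Sum>k\<in>fejer_index n. ?c k * ?c (k + L)) = overlap_sum L n / (real n)\<^sup>2"
    by (simp add: sum_tent_shift[symmetric] sum_divide_distrib power2_eq_square)
  finally show ?thesis .
qed

lemma torus_inner_op_B_fejer:
  fixes L :: "int ^ 'd"
  assumes "n > 0"
  shows "torus_inner (op_B L (fejer_kernel n)) (op_B L (fejer_kernel n)) = of_real (moment_sum L n / (real n)\<^sup>2)"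
proof -
  let ?c = "\<lambda>k. tent n k / real n" and ?l = "\<lambda>k. real_of_int (\<Sum>j\<in>UNIV. L $ j * k $ j)"
  have "torus_inner (op_B L (fejer_kernel n)) (op_B L (fejer_kernel n))
      = of_real (\<Sum>k\<in>fejer_index n. (?l k)\<^sup>2 * (?c k * ?c k))"
    unfolding fejer_kernel_eq[OF assms] op_B_trig_sum
    by (subst torus_inner_trig_sums) (simp_all add: finite_fejer_index_set power2_eq_square mult_ac)
  also have "(\<Sum>k\<in>fejer_index n. (?l k)\<^sup>2 * (?c k * ?c k)) = moment_sum L n / (real n)\<^sup>2"
    using sum_tent_product[of "\<lambda>k. (?l k)\<^sup>2" n 0]
    by (simp add: moment_sum_def cube_overlap_zero sum_divide_distrib[symmetric] power2_eq_square[of "real n"])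
  finally show ?thesis .
qed

text \<open>The linear form <L, k> is odd in k, while the tent and the index set are symmetric, so
  the sum equals its own negative.\<close>

lemma torus_inner_op_B_fejer_mean:
  fixes L :: "int ^ 'd"
  assumes "n > 0"
  shows "torus_inner (op_B L (fejer_kernel n)) (fejer_kernel n) = 0"
proof -
  let ?l = "\<lambda>k. real_of_int (\<Sum>j\<in>UNIV. L $ j * k $ j)"
  let ?h = "\<lambda>k. ?l k * (tent n k / real n)\<^sup>2"
  have cube_minus: "- k \<in> lattice_cube r \<longleftrightarrow> k \<in> lattice_cube r" for k :: "int ^ 'd" and r
    by (auto simp: lattice_cube_def) (smt (verit))+
  have index_minus: "- k \<in> fejer_index n \<longleftrightarrow> k \<in> fejer_index n" for k :: "int ^ 'd"
  proof -
    have "real_vec (- k) = - real_vec k"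
      by (simp add: real_vec_def vec_eq_iff)
    then show ?thesis
      by (simp add: fejer_index_def infnorm_neg)
  qed
  have odd: "?h (- k) = - ?h k" for k
    by (simp add: tent_def cube_minus sum_negf)
  have "(\<Sum>k\<in>fejer_index n. ?h k) = (\<Sum>k\<in>fejer_index n. ?h (- k))"
    by (rule sum.reindex_bij_witness[of _ uminus uminus]) (simp_all add: index_minus)
  then have "(\<Sum>k\<in>fejer_index n. ?h k) = 0"
    unfolding odd by (simp add: sum_negf)
  moreover have "torus_inner (op_B L (fejer_kernel n)) (fejer_kernel n)
      = of_real (- (\<Sum>k\<in>fejer_index n. ?h k))"
    unfolding fejer_kernel_eq[OF assms] op_B_trig_sum
    by (subst torus_inner_trig_sums) (simp_all add: finite_fejer_index_set power2_eq_square mult_ac sum_negf)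
  ultimately show ?thesis
    by simp
qed

text \<open>All the lattice sums carry the same factor 1/n^2, which cancels in both parentheses, and
  the mean of B_L vanishes.\<close>

lemma UP_fejer_kernel:
  fixes L :: "int ^ 'd"
  assumes "n > 0"
  shows "UP L (fejer_kernel n) = 1 / norm (real_vec L) ^ 4
    * ((overlap_sum (0 :: int ^ 'd) n)\<^sup>2 / (overlap_sum L n)\<^sup>2 - 1)
    * (moment_sum L n / overlap_sum (0 :: int ^ 'd) n)"
proof -
  let ?F = "fejer_kernel n :: real ^ 'd \<Rightarrow> complex"
  have nonneg: "overlap_sum (0 :: int ^ 'd) n \<ge> 0" "moment_sum L n \<ge> 0"
    by (auto simp: overlap_sum_def moment_sum_def intro!: sum_nonneg)
  have F: "(torus_norm ?F)\<^sup>2 = overlap_sum (0 :: int ^ 'd) n / (real n)\<^sup>2"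
    using nonneg by (simp add: torus_norm_eq_inner torus_inner_fejer[OF assms])
  have F4: "torus_norm ?F ^ 4 = (overlap_sum (0 :: int ^ 'd) n / (real n)\<^sup>2)\<^sup>2"
    unfolding F[symmetric] by simp
  have B: "(torus_norm (op_B L ?F))\<^sup>2 = moment_sum L n / (real n)\<^sup>2"
    using nonneg by (simp add: torus_norm_eq_inner torus_inner_op_B_fejer[OF assms])
  have A: "(cmod (torus_inner (op_A L ?F) ?F))\<^sup>2 = (overlap_sum L n / (real n)\<^sup>2)\<^sup>2"
    by (simp only: torus_inner_op_A_fejer[OF assms] norm_of_real power2_abs)
  show ?thesis
    unfolding UP_def F F4 A B torus_inner_op_B_fejer_mean[OF assms]
    using assms by (simp add: power_divide)
qed

section \<open>Growth rates of the lattice sums\<close>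

lemma overlap_sum_zero_growth:
  "(\<lambda>n. overlap_sum (0 :: int ^ 'd) n / real n ^ (CARD('d) + 2))
    \<longlonglongrightarrow> 2 * 2 ^ CARD('d) / ((real CARD('d) + 1) * (real CARD('d) + 2))"
  unfolding overlap_sum_def cube_overlap_zero card_lattice_cube
proof (rule double_sum_min_growth)
  show "(\<lambda>n. (2 * real n + 1) ^ CARD('d) / real n ^ CARD('d)) \<longlonglongrightarrow> 2 ^ CARD('d)"
    unfolding power_divide[symmetric] by (intro tendsto_power tendsto_two_plus_inverse)
qed

lemma norm_real_vec_square:
  fixes L :: "int ^ 'd"
  shows "(norm (real_vec L))\<^sup>2 = (\<Sum>j\<in>UNIV. (real_of_int (L $ j))\<^sup>2)"
  by (simp only: power2_norm_eq_inner) (simp add: inner_vec_def real_vec_def power2_eq_square)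

text \<open>The second moment over a cube of radius r grows like ||L||^2 2^d r^(d+2) / 3, to which
  \<open>double_sum_min_growth\<close> applies with exponent d + 2.\<close>

lemma moment_sum_growth:
  fixes L :: "int ^ 'd"
  shows "(\<lambda>n. moment_sum L n / real n ^ (CARD('d) + 4))
    \<longlonglongrightarrow> 2 * ((norm (real_vec L))\<^sup>2 * 2 ^ CARD('d) / 3) / ((real CARD('d) + 3) * (real CARD('d) + 4))"
proof -
  let ?W = "\<lambda>n. (norm (real_vec L))\<^sup>2 * ((2 * real n + 1) ^ CARD('d) * (real n * (real n + 1) / 3))"
  have "(\<lambda>n. (norm (real_vec L))\<^sup>2 * (((2 * real n + 1) / real n) ^ CARD('d) * ((real n + 1) / real n) / 3))
      \<longlonglongrightarrow> (norm (real_vec L))\<^sup>2 * (2 ^ CARD('d) * 1 / 3)"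
    by (intro tendsto_intros tendsto_two_plus_inverse tendsto_shift_ratio) simp
  moreover have "eventually (\<lambda>n. (norm (real_vec L))\<^sup>2 * (((2 * real n + 1) / real n) ^ CARD('d) * ((real n + 1) / real n) / 3)
      = ?W n / real n ^ (CARD('d) + 2)) sequentially"
    using eventually_gt_at_top[of 0]
    by eventually_elim (simp add: power_divide power_add power2_eq_square field_simps)
  ultimately have "(\<lambda>n. ?W n / real n ^ (CARD('d) + 2)) \<longlonglongrightarrow> (norm (real_vec L))\<^sup>2 * (2 ^ CARD('d) * 1 / 3)"
    by (rule Lim_transform_eventually)
  then have W: "(\<lambda>n. ?W n / real n ^ (CARD('d) + 2)) \<longlonglongrightarrow> (norm (real_vec L))\<^sup>2 * 2 ^ CARD('d) / 3"
    by (simp only: mult_1_right times_divide_eq_right)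
  have dim: "CARD('d) + 2 + 2 = CARD('d) + 4" "real (CARD('d) + 2) + 1 = real CARD('d) + 3"
    "real (CARD('d) + 2) + 2 = real CARD('d) + 4"
    by simp_all
  show ?thesis
    using double_sum_min_growth[OF W]
    unfolding moment_sum_def sum_square_linear_form_lattice_cube norm_real_vec_square[symmetric] dim .
qed

text \<open>The defect is a symmetric double sum supported in a band, with entries of order m^(d-1),
  so its order is n^d rather than n^(d+2).\<close>

lemma overlap_sum_defect_growth:
  fixes L :: "int ^ 'd"
  shows "(\<lambda>n. (overlap_sum (0 :: int ^ 'd) n - overlap_sum L n) / real n ^ CARD('d))
    \<longlonglongrightarrow> 2 ^ (CARD('d) - 1) * (norm (real_vec L))\<^sup>2 / real CARD('d)"
proof -
  let ?a = "\<lambda>j. nat \<bar>L $ j\<bar>"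
  \<comment> \<open>Any bound on all |L_j| serves as band width; their sum is a convenient
    one.\<close>
  define l where "l = (\<Sum>j\<in>UNIV. ?a j)"
  have l: "?a j \<le> l" for j
    unfolding l_def using member_le_sum[of j UNIV ?a] by simp
  define G where "G = (\<lambda>r s. (2 * real (min r s) + 1) ^ CARD('d) - real (card (cube_overlap L r s)))"
  define c where "c = (\<lambda>t. 2 ^ (CARD('d) - 1) * (\<Sum>j\<in>UNIV. real (?a j - t)))"
  have G0: "G m (m + t) = 0" if "t > l" for m t
  proof -
    have "?a j \<le> t" for j
      using l[of j] that by linarith
    then show ?thesis
      by (simp add: G_def cube_overlap_eq_cube card_lattice_cube)
  qed
  have "(\<lambda>n. (\<Sum>r<n. \<Sum>s<n. G r s) / real n ^ Suc (CARD('d) - 1))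
      \<longlonglongrightarrow> (c 0 + 2 * (\<Sum>t=1..l. c t)) / real (Suc (CARD('d) - 1))"
  proof (rule double_sum_band_growth)
    show "G r s = G s r" for r s
      by (simp add: G_def min.commute card_cube_overlap_commute)
    show "(\<lambda>m. G m (m + t) / real m ^ (CARD('d) - 1)) \<longlonglongrightarrow> c t" for t
      using cube_overlap_defect_limit[of L t] by (simp add: G_def c_def)
  qed (rule G0)
  moreover have "c 0 + 2 * (\<Sum>t=1..l. c t) = 2 ^ (CARD('d) - 1) * (norm (real_vec L))\<^sup>2"
  proof -
    have "(\<Sum>t=1..l. c t) = 2 ^ (CARD('d) - 1) * (\<Sum>j\<in>UNIV. \<Sum>t=1..l. real (?a j - t))"
      unfolding c_def sum_distrib_left[symmetric] by (subst sum.swap) simp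
    moreover have "c 0 = 2 ^ (CARD('d) - 1) * (\<Sum>j\<in>UNIV. real (?a j))"
      by (simp add: c_def)
    ultimately have "c 0 + 2 * (\<Sum>t=1..l. c t)
        = 2 ^ (CARD('d) - 1) * (\<Sum>j\<in>UNIV. real (?a j) + 2 * (\<Sum>t=1..l. real (?a j - t)))"
      by (simp only: sum.distrib sum_distrib_left[symmetric] distrib_left mult.left_commute)
    also have "(\<Sum>j\<in>UNIV. real (?a j) + 2 * (\<Sum>t=1..l. real (?a j - t))) = (\<Sum>j\<in>UNIV. (real (?a j))\<^sup>2)"
      by (intro sum.cong refl sum_truncated_diff_eq_square l)
    also have "\<dots> = (norm (real_vec L))\<^sup>2"
      by (simp add: norm_real_vec_square)
    finally show ?thesis .
  qed
  moreover have "(\<Sum>r<n. \<Sum>s<n. G r s) = overlap_sum (0 :: int ^ 'd) n - overlap_sum L n" for n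
    by (simp add: overlap_sum_def G_def cube_overlap_zero card_lattice_cube sum_subtractf)
  ultimately show ?thesis
    by simp
qed

theorem lemma5:
  fixes L :: "int ^ 'd"
  assumes "L \<noteq> 0"
  shows "(\<lambda>n. UP L (fejer_kernel n)) \<longlonglongrightarrow>
    (real CARD('d) + 1)\<^sup>2 * (real CARD('d) + 2)\<^sup>2
      / (6 * real CARD('d) * (real CARD('d) + 3) * (real CARD('d) + 4))"
proof -
  let ?d = "CARD('d)" and ?\<nu> = "(norm (real_vec L))\<^sup>2"
  let ?S = "overlap_sum (0 :: int ^ 'd)" and ?A = "overlap_sum L" and ?B = "moment_sum L"
  let ?\<sigma> = "2 * 2 ^ ?d / ((real ?d + 1) * (real ?d + 2))"
  let ?\<tau> = "2 ^ (?d - 1) * ?\<nu> / real ?d"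
  let ?\<beta> = "2 * (?\<nu> * 2 ^ ?d / 3) / ((real ?d + 3) * (real ?d + 4))"
  define x where "x = (\<lambda>n. ?S n / real n ^ (?d + 2))"
  define a where "a = (\<lambda>n. ?A n / real n ^ (?d + 2))"
  define t where "t = (\<lambda>n. (?S n - ?A n) / real n ^ ?d)"
  define b where "b = (\<lambda>n. ?B n / real n ^ (?d + 4))"
  have \<nu>: "?\<nu> \<noteq> 0"
    using assms by (auto simp: real_vec_def vec_eq_iff)
  have \<sigma>: "?\<sigma> \<noteq> 0"
    by simp
  have x: "x \<longlonglongrightarrow> ?\<sigma>"
    unfolding x_def by (rule overlap_sum_zero_growth)
  have t: "t \<longlonglongrightarrow> ?\<tau>"
    unfolding t_def by (rule overlap_sum_defect_growth)
  have b: "b \<longlonglongrightarrow> ?\<beta>"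
    unfolding b_def by (rule moment_sum_growth)
  \<comment> \<open>The defect is two orders below the main term, so both overlap sums have the same
    leading coefficient.\<close>
  have a: "a \<longlonglongrightarrow> ?\<sigma>"
  proof -
    have "(\<lambda>n. x n - t n * (1 / real n) * (1 / real n)) \<longlonglongrightarrow> ?\<sigma> - ?\<tau> * 0 * 0"
      by (intro tendsto_intros x t lim_const_over_n)
    moreover have "x n - t n * (1 / real n) * (1 / real n) = a n" for n
      by (simp add: x_def t_def a_def power_add power2_eq_square diff_divide_distrib)
    ultimately show ?thesis
      by simp
  qed
  \<comment> \<open>S^2/A^2 - 1 is written as (S - A)(S + A)/A^2, so that the cancellation is
    carried by the known growth of S - A. The normalised first factor gains n^2 and the second
    n^(-2), so their product is unchanged.\<close>
  have "(\<lambda>n. 1 / ?\<nu>\<^sup>2 * (t n * (x n + a n) / (a n)\<^sup>2) * (b n / x n))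
      \<longlonglongrightarrow> 1 / ?\<nu>\<^sup>2 * (?\<tau> * (?\<sigma> + ?\<sigma>) / ?\<sigma>\<^sup>2) * (?\<beta> / ?\<sigma>)"
    by (intro tendsto_intros a x t b \<sigma>) (use \<sigma> in simp)
  moreover have "eventually (\<lambda>n. 1 / ?\<nu>\<^sup>2 * (t n * (x n + a n) / (a n)\<^sup>2) * (b n / x n)
      = UP L (fejer_kernel n)) sequentially"
    using eventually_gt_at_top[of 0] tendsto_imp_eventually_ne[OF a \<sigma>] tendsto_imp_eventually_ne[OF x \<sigma>]
  proof eventually_elim
    case (elim n)
    then have S: "?S n \<noteq> 0" and A: "?A n \<noteq> 0"
      by (auto simp: x_def a_def)
    let ?m = "real n" and ?p = "real n ^ ?d"
    have m: "?m \<noteq> 0" "?p \<noteq> 0"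
      using elim by simp_all
    have "t n * (x n + a n) / (a n)\<^sup>2 = ?m\<^sup>2 * ((?S n)\<^sup>2 / (?A n)\<^sup>2 - 1)"
      using A m by (simp add: x_def a_def t_def power_add field_simps power2_eq_square)
    moreover have "b n / x n = ?B n / ?S n / ?m\<^sup>2"
      using S m by (simp add: x_def b_def power_add field_simps power2_eq_square power4_eq_xxxx)
    ultimately show ?case
      using elim(1) by (simp add: UP_fejer_kernel)
  qed
  ultimately have "(\<lambda>n. UP L (fejer_kernel n)) \<longlonglongrightarrow> 1 / ?\<nu>\<^sup>2 * (?\<tau> * (?\<sigma> + ?\<sigma>) / ?\<sigma>\<^sup>2) * (?\<beta> / ?\<sigma>)"
    by (rule Lim_transform_eventually)
  also have "1 / ?\<nu>\<^sup>2 * (?\<tau> * (?\<sigma> + ?\<sigma>) / ?\<sigma>\<^sup>2) * (?\<beta> / ?\<sigma>)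
      = (real ?d + 1)\<^sup>2 * (real ?d + 2)\<^sup>2 / (6 * real ?d * (real ?d + 3) * (real ?d + 4))"
  proof -
    \<comment> \<open>Here P = 2^(d-1), N = ||L||^2, D = d and s is the limit of \<open>x\<close>;
      all powers of P and N cancel, so the limit depends on d alone.\<close>
    have eq: "1 / N\<^sup>2 * (P * N / D * (s + s) / s\<^sup>2) * (2 * (N * (2 * P) / 3) / ((D + 3) * (D + 4)) / s)
        = (D + 1)\<^sup>2 * (D + 2)\<^sup>2 / (6 * D * (D + 3) * (D + 4))"
      if "P > 0" "N > 0" "D > 0" and s: "s = 2 * (2 * P) / ((D + 1) * (D + 2))" for P N D s :: real
    proof -
      have "s > 0" "D + 1 > 0" "D + 2 > 0" "D + 3 > 0" "D + 4 > 0"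
        using that by simp_all
      have "1 / N\<^sup>2 * (P * N / D * (s + s) / s\<^sup>2) * (2 * (N * (2 * P) / 3) / ((D + 3) * (D + 4)) / s)
          = 8 * P\<^sup>2 / (3 * D * (D + 3) * (D + 4) * s\<^sup>2)"
        using that(1-3) \<open>s > 0\<close> \<open>D + 3 > 0\<close> \<open>D + 4 > 0\<close> by (simp add: divide_simps power2_eq_square)
      also have "\<dots> = (D + 1)\<^sup>2 * (D + 2)\<^sup>2 / (6 * D * (D + 3) * (D + 4))"
        using that(1) by (simp add: s power_divide power_mult_distrib)
      finally show ?thesis .
    qed
    have P: "2 ^ ?d = 2 * (2::real) ^ (?d - 1)"
      using power_minus_mult[of ?d "2 :: real"] by simp
    have pos: "(2::real) ^ (?d - 1) > 0" "?\<nu> > 0" "real ?d > 0"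
      using \<nu> by simp_all
    show ?thesis
      unfolding P by (rule eq[OF pos refl])
  qed
  finally show ?thesis .
qed

end
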